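(* Let $S$ be a finite centrally symmetric point set in the plane that is in convex position. Then there exists a plane geometric graph with vertex set $S$ whose stretch factor is at most $\pi+1$ and whose maximum vertex degree is at most $3$.
   Context: $S$ is centrally symmetric (with respect to the origin) if $-p\in S$ for every $p\in S$. A geometric graph on $S$ has straight-segment edges weighted by Euclidean length; $d_G(u,v)$ is the shortest-path length. Its stretch factor is the smallest $t$ with $d_G(u,v)\le t|uv|$ for all $u,v\in S$. A graph is plane if no two edges cross. *)

theory Defs
  imports "HOL-Analysis.Analysis"
begin

type_synonym point = "real ^ 2"

definition centrally_symmetric :: "point set \<Rightarrow> bool" where
  "centrally_symmetric S \<longleftrightarrow> (\<forall>p\<in>S. - p \<in> S)"

definition convex_position :: "point set \<Rightarrow> bool" where
  "convex_position S \<longleftrightarrow> (\<forall>p\<in>S. p \<notin> convex hull (S - {p}))"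

definition geometric_graph :: "point set \<Rightarrow> point set set \<Rightarrow> bool" where
  "geometric_graph S E \<longleftrightarrow> (\<forall>e\<in>E. \<exists>u v. e = {u, v} \<and> u \<noteq> v \<and> u \<in> S \<and> v \<in> S)"

definition plane_graph :: "point set set \<Rightarrow> bool" where
  "plane_graph E \<longleftrightarrow>
     (\<forall>e1\<in>E. \<forall>e2\<in>E. e1 \<noteq> e2 \<longrightarrow> convex hull e1 \<inter> convex hull e2 \<subseteq> e1 \<inter> e2)"

definition degree :: "point set set \<Rightarrow> point \<Rightarrow> nat" where
  "degree E v = card {u. {u, v} \<in> E \<and> u \<noteq> v}"

definition is_walk :: "point set set \<Rightarrow> point \<Rightarrow> point list \<Rightarrow> point \<Rightarrow> bool" where
  "is_walk E u xs v \<longleftrightarrow> xs \<noteq> [] \<and> hd xs = u \<and> last xs = v \<and>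
     (\<forall>i < length xs - 1. {xs ! i, xs ! Suc i} \<in> E)"

definition walk_length :: "point list \<Rightarrow> real" where
  "walk_length xs = (\<Sum>i < length xs - 1. dist (xs ! i) (xs ! Suc i))"

text \<open>Stretch factor at most t: for all u, v in S, the shortest-path distance
  (minimum of walk lengths, attained in a finite graph) is at most t |uv|.\<close>
definition stretch_factor_le :: "point set \<Rightarrow> point set set \<Rightarrow> real \<Rightarrow> bool" where
  "stretch_factor_le S E t \<longleftrightarrow>
     (\<forall>u\<in>S. \<forall>v\<in>S. \<exists>xs. is_walk E u xs v \<and> walk_length xs \<le> t * dist u v)"

end

theory Submission
  imports Defs
begin

text \<open>Let \<open>p\<close> be a point of \<open>S\<close> farthest from the origin. The line through \<open>\<plusminus>p\<close> splits the hull into two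
  chains that are concave and convex graphs over it, and \<open>S\<close> lies in the disc with diameter from
  \<open>- p\<close> to \<open>p\<close>. Hence any point between \<open>u\<close> and \<open>v\<close> on one chain lies in the disc with diameter \<open>uv\<close>,
  and the chain from \<open>u\<close> to \<open>v\<close> has length at most \<open>\<pi>/2\<close> times \<open>|uv|\<close>. Besides the hull edges take a
  non-crossing matching between the chains in which every pair \<open>u\<close>, \<open>v\<close> on different chains meets
  or crosses a matching edge \<open>ab\<close> with \<open>|ab| \<le> |uv|\<close>. Then \<open>|ua| + |bv| \<le> |uv| + |ab| \<le> 2 |uv|\<close>, so going
  along the chains and over \<open>ab\<close> costs at most \<open>(2 \<cdot> \<pi>/2 + 1) |uv|\<close>.\<close>

section \<open>Projections of a chain\<close>

text \<open>With \<open>x > 0\<close> the polar angle \<open>\<phi>\<close> lies in (-pi/2, pi/2),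
  so the integrand is \<open>r * \<bar>cos (t - \<phi>)\<bar>\<close> and its only zero in [0, pi]
  is at \<open>\<phi> + pi/2\<close>. The integral is split there.\<close>

lemma crofton_integral:
  fixes x y :: real
  assumes "x > 0"
  shows "((\<lambda>t. \<bar>cos t * x + sin t * y\<bar>) has_integral 2 * sqrt (x\<^sup>2 + y\<^sup>2)) {0..pi}"
proof -
  define r where "r = sqrt (x\<^sup>2 + y\<^sup>2)"
  define \<phi> where "\<phi> = arctan (y / x)"
  have phi: "- (pi/2) < \<phi>" "\<phi> < pi/2"
    unfolding \<phi>_def using arctan_bounded[of "y/x"] by auto
  have r0: "r > 0" unfolding r_def using assms by (simp add: add_pos_nonneg)
  have sq: "sqrt (1 + (y / x)\<^sup>2) = r / x"
  proof -
    have "1 + (y / x)\<^sup>2 = (x\<^sup>2 + y\<^sup>2) / x\<^sup>2" using assms by (simp add: field_simps)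
    then show ?thesis using assms by (simp add: r_def real_sqrt_divide)
  qed
  have xy: "x = r * cos \<phi>" "y = r * sin \<phi>"
    unfolding \<phi>_def cos_arctan sin_arctan sq using assms r0 by auto
  have form: "cos t * x + sin t * y = r * cos (t - \<phi>)" for t
    by (simp add: xy cos_diff algebra_simps)
  have "((\<lambda>t. r * cos (t - \<phi>)) has_integral (r * sin (\<phi> + pi/2 - \<phi>) - r * sin (0 - \<phi>))) {0..\<phi> + pi/2}"
    by (rule fundamental_theorem_of_calculus)
       (use phi in \<open>auto intro!: derivative_eq_intros simp flip: has_real_derivative_iff_has_vector_derivative\<close>)
  then have 1: "((\<lambda>t. \<bar>cos t * x + sin t * y\<bar>) has_integral r * (1 + sin \<phi>)) {0..\<phi> + pi/2}"
  proof (rule has_integral_eq_rhs[OF has_integral_eq, rotated])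
    fix t assume "t \<in> {0..\<phi> + pi/2}"
    then have "cos (t - \<phi>) \<ge> 0" using phi by (intro cos_ge_zero) auto
    then show "r * cos (t - \<phi>) = \<bar>cos t * x + sin t * y\<bar>"
      unfolding form using r0 by simp
  qed (simp add: algebra_simps)
  have "((\<lambda>t. - (r * cos (t - \<phi>))) has_integral (- (r * sin (pi - \<phi>)) - (- (r * sin (\<phi> + pi/2 - \<phi>))))) {\<phi> + pi/2..pi}"
    by (rule fundamental_theorem_of_calculus)
       (use phi in \<open>auto intro!: derivative_eq_intros simp flip: has_real_derivative_iff_has_vector_derivative\<close>)
  then have 2: "((\<lambda>t. \<bar>cos t * x + sin t * y\<bar>) has_integral r * (1 - sin \<phi>)) {\<phi> + pi/2..pi}"
  proof (rule has_integral_eq_rhs[OF has_integral_eq, rotated])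
    fix t assume t: "t \<in> {\<phi> + pi/2..pi}"
    then have "cos (pi - (t - \<phi>)) \<ge> 0" using phi by (intro cos_ge_zero) auto
    then have "cos (t - \<phi>) \<le> 0" by (simp add: cos_diff)
    then show "- (r * cos (t - \<phi>)) = \<bar>cos t * x + sin t * y\<bar>"
      unfolding form using r0 by (simp add: abs_mult)
  qed (simp add: algebra_simps)
  show ?thesis
    using has_integral_combine[OF _ _ 1 2] phi by (simp add: r_def algebra_simps)
qed

text \<open>Once a step fails to rise, no later step rises, so \<open>f\<close> climbs to a peak
  \<open>m\<close> and then descends; the two stretches telescope to \<open>f m - f a\<close> and
  \<open>f m - f b\<close>.\<close>

lemma unimodal_variation:
  fixes f :: "nat \<Rightarrow> real"
  assumes "a \<le> b"
    and "\<And>i. a \<le> i \<Longrightarrow> Suc i < b \<Longrightarrow> f (Suc i) \<le> f i \<Longrightarrow> f (Suc (Suc i)) \<le> f (Suc i)"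
  shows "\<exists>m\<in>{a..b}. (\<Sum>i=a..<b. \<bar>f (Suc i) - f i\<bar>) = 2 * f m - f a - f b"
proof -
  \<comment> \<open>The second conjunct strengthens the induction: either the variation is still the
    net rise, or the last step was not a rise, and then the next one cannot be.\<close>
  have "(\<exists>m\<in>{a..b}. (\<Sum>i=a..<b. \<bar>f (Suc i) - f i\<bar>) = 2 * f m - f a - f b) \<and>
    ((\<Sum>i=a..<b. \<bar>f (Suc i) - f i\<bar>) = f b - f a \<or> (\<exists>c. b = Suc c \<and> a \<le> c \<and> f b \<le> f c))"
    using assms
  proof (induction b rule: dec_induct)
    case base
    show ?case by auto
  next
    case (step k)
    let ?V = "\<lambda>k. \<Sum>i=a..<k. \<bar>f (Suc i) - f i\<bar>"
    have V: "?V (Suc k) = ?V k + \<bar>f (Suc k) - f k\<bar>" using step.hyps by simp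
    have IH: "\<exists>m\<in>{a..k}. ?V k = 2 * f m - f a - f k"
      "?V k = f k - f a \<or> (\<exists>c. k = Suc c \<and> a \<le> c \<and> f k \<le> f c)"
      using step by auto
    show ?case
    proof (cases "f (Suc k) \<le> f k")
      case True
      from IH(1) obtain m where "m \<in> {a..k}" "?V k = 2 * f m - f a - f k" by blast
      then have "m \<in> {a..Suc k}" "?V (Suc k) = 2 * f m - f a - f (Suc k)"
        using V True by auto
      then show ?thesis using True step.hyps by blast
    next
      case False
      then have "?V k = f k - f a" using IH(2) step.prems by force
      then have "?V (Suc k) = f (Suc k) - f a" using V False by simp
      then show ?thesis using step.hyps by (intro conjI bexI[of _ "Suc k"]) auto
    qed
  qed
  then show ?thesis by blast
qed

section \<open>Matchings and walks\<close>

text \<open>The matching is built by pairing a closest pair and recursing on both sides of it.\<close>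

lemma blocking_matching:
  fixes A :: "'a::linorder set" and B :: "'b::linorder set" and d :: "'a \<Rightarrow> 'b \<Rightarrow> real"
  assumes "finite A" "finite B"
  shows "\<exists>M \<subseteq> A \<times> B.
    (\<forall>(a,b)\<in>M. \<forall>(a',b')\<in>M. a < a' \<longleftrightarrow> b' < b) \<and>
    (\<forall>u\<in>A. \<forall>v\<in>B. \<exists>(a,b)\<in>M. d a b \<le> d u v \<and> \<not> (u < a \<and> b < v) \<and> \<not> (a < u \<and> v < b))"
  using assms
proof (induction A arbitrary: B rule: finite_psubset_induct)
  case (psubset A)
  show ?case
  proof (cases "A = {} \<or> B = {}")
    case True
    then show ?thesis by auto
  next
    case False
    define P where "P = A \<times> B"
    have "finite P" "P \<noteq> {}" using False psubset by (auto simp: P_def)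
    then obtain m where m: "m \<in> P" "\<And>z. z \<in> P \<Longrightarrow> case_prod d m \<le> case_prod d z"
      using arg_min_if_finite(1) arg_min_least by metis
    obtain a b where ab: "m = (a, b)" by fastforce
    have aA: "a \<in> A" "b \<in> B" using m ab by (auto simp: P_def)
    have closest: "d a b \<le> d u v" if "u \<in> A" "v \<in> B" for u v
      using m(2)[of "(u,v)"] that ab by (auto simp: P_def)
    have sub: "{x\<in>A. x < a} \<subset> A" "{x\<in>A. a < x} \<subset> A" using aA by auto
    \<comment> \<open>Pairs nested with \<open>(a, b)\<close> lie below \<open>a\<close> and above
      \<open>b\<close>, or the reverse. Recursing on these two blocks keeps all chosen pairs
      nested.\<close>
    obtain M1 where M1: "M1 \<subseteq> {x\<in>A. x < a} \<times> {x\<in>B. b < x}"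
      "\<forall>(a,b)\<in>M1. \<forall>(a',b')\<in>M1. a < a' \<longleftrightarrow> b' < b"
      "\<forall>u\<in>{x\<in>A. x < a}. \<forall>v\<in>{x\<in>B. b < x}. \<exists>(a,b)\<in>M1. d a b \<le> d u v \<and> \<not> (u < a \<and> b < v) \<and> \<not> (a < u \<and> v < b)"
      using psubset.IH[OF sub(1), of "{x\<in>B. b < x}"] psubset.prems by auto
    obtain M2 where M2: "M2 \<subseteq> {x\<in>A. a < x} \<times> {x\<in>B. x < b}"
      "\<forall>(a,b)\<in>M2. \<forall>(a',b')\<in>M2. a < a' \<longleftrightarrow> b' < b"
      "\<forall>u\<in>{x\<in>A. a < x}. \<forall>v\<in>{x\<in>B. x < b}. \<exists>(a,b)\<in>M2. d a b \<le> d u v \<and> \<not> (u < a \<and> b < v) \<and> \<not> (a < u \<and> v < b)"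
      using psubset.IH[OF sub(2), of "{x\<in>B. x < b}"] psubset.prems by auto
    define M where "M = insert (a,b) (M1 \<union> M2)"
    have "M \<subseteq> A \<times> B" using M1(1) M2(1) aA by (auto simp: M_def)
    moreover have "x < x' \<longleftrightarrow> y' < y" if xy: "(x,y) \<in> M" "(x',y') \<in> M" for x y x' y'
    proof -
      have *: "(z1 < a \<and> b < z2)" if "(z1,z2) \<in> M1" for z1 z2 using M1(1) that by auto
      have **: "(a < z1 \<and> z2 < b)" if "(z1,z2) \<in> M2" for z1 z2 using M2(1) that by auto
      consider "(x,y) \<in> M1" "(x',y') \<in> M1" | "(x,y) \<in> M2" "(x',y') \<in> M2"
        | "(x,y) \<in> M1" "(x',y') \<in> M2" | "(x,y) \<in> M2" "(x',y') \<in> M1"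
        | "(x,y) = (a,b)" | "(x',y') = (a,b)"
        using xy unfolding M_def by blast
      then show ?thesis
      proof cases
        case 1 then show ?thesis using M1(2) by blast
      next
        case 2 then show ?thesis using M2(2) by blast
      next
        case 3 then show ?thesis using *[of x y] **[of x' y'] by auto
      next
        case 4 then show ?thesis using *[of x' y'] **[of x y] by auto
      next
        case 5 then show ?thesis using xy(2) *[of x' y'] **[of x' y'] by (auto simp: M_def)
      next
        case 6 then show ?thesis using xy(1) *[of x y] **[of x y] by (auto simp: M_def)
      qed
    qed
    moreover have "\<exists>(a,b)\<in>M. d a b \<le> d u v \<and> \<not> (u < a \<and> b < v) \<and> \<not> (a < u \<and> v < b)"
      if uv: "u \<in> A" "v \<in> B" for u v
    proof -
      \<comment> \<open>A pair inside a block is handled by the recursion. Any other pair is not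
        nested with \<open>(a, b)\<close>, which serves because its distance is minimal.\<close>
      consider "u < a" "b < v" | "a < u" "v < b" | "\<not> (u < a \<and> b < v)" "\<not> (a < u \<and> v < b)"
        by blast
      then show ?thesis
      proof cases
        case 1
        then have "\<exists>(a,b)\<in>M1. d a b \<le> d u v \<and> \<not> (u < a \<and> b < v) \<and> \<not> (a < u \<and> v < b)"
          using M1(3) uv by simp
        then show ?thesis unfolding M_def by blast
      next
        case 2
        then have "\<exists>(a,b)\<in>M2. d a b \<le> d u v \<and> \<not> (u < a \<and> b < v) \<and> \<not> (a < u \<and> v < b)"
          using M2(3) uv by simp
        then show ?thesis unfolding M_def by blast
      next
        case 3
        then show ?thesis using closest[OF uv] by (auto simp: M_def)
      qed
    qed
    ultimately show ?thesis by (intro exI[of _ M]) fast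
  qed
qed

text \<open>The length is an index, so that walks are concatenated and reversed by rule induction;
  lists enter only in \<open>walk_imp_is_walk\<close>.\<close>

inductive walk :: "point set set \<Rightarrow> real \<Rightarrow> point \<Rightarrow> point \<Rightarrow> bool" for E where
  refl: "walk E 0 u u"
| step: "{u, x} \<in> E \<Longrightarrow> walk E l x v \<Longrightarrow> walk E (dist u x + l) u v"

lemma walk_imp_is_walk:
  "walk E l u v \<Longrightarrow> \<exists>xs. is_walk E u xs v \<and> walk_length xs = l"
proof (induction rule: walk.induct)
  case (refl u)
  show ?case by (rule exI[of _ "[u]"]) (simp add: is_walk_def walk_length_def)
next
  case (step u x l v)
  then obtain xs where xs: "is_walk E x xs v" "walk_length xs = l" by blast
  then obtain ys where ys: "xs = x # ys" by (cases xs) (auto simp: is_walk_def)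
  have "is_walk E u (u # xs) v"
    using xs(1) step.hyps(1) unfolding is_walk_def ys by (auto simp: nth_Cons split: nat.splits)
  moreover have "walk_length (u # xs) = dist u x + l"
    using xs(2) unfolding walk_length_def ys
    by (simp add: sum.lessThan_Suc_shift del: sum.lessThan_Suc)
  ultimately show ?case by blast
qed

lemma walk_trans: "walk E l u v \<Longrightarrow> walk E k v x \<Longrightarrow> walk E (l + k) u x"
proof (induction rule: walk.induct)
  case (step u y l v)
  then show ?case using walk.step[of u y E "l + k" x] by (simp add: add.assoc)
qed simp

lemma walk_edge: "{u, v} \<in> E \<Longrightarrow> walk E (dist u v) u v"
  using walk.step[OF _ walk.refl] by fastforce

lemma walk_sym: "walk E l u v \<Longrightarrow> walk E l v u"
proof (induction rule: walk.induct)
  case (step u x l v)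
  then have "{x, u} \<in> E" by (simp add: insert_commute)
  from walk_trans[OF step.IH walk_edge[OF this]] show ?case
    by (simp add: dist_commute add.commute)
qed (rule walk.refl)

lemma walk_chain:
  assumes "a \<le> b" "\<And>i. a \<le> i \<Longrightarrow> i < b \<Longrightarrow> {w i, w (Suc i)} \<in> E"
  shows "walk E (\<Sum>i=a..<b. dist (w i) (w (Suc i))) (w a) (w b)"
  using assms
proof (induction b rule: dec_induct)
  case base
  show ?case by (simp add: walk.refl)
next
  case (step k)
  have "walk E (\<Sum>i=a..<k. dist (w i) (w (Suc i))) (w a) (w k)" using step by auto
  from walk_trans[OF this walk_edge[of "w k" "w (Suc k)"]] step show ?case by simp
qed

section \<open>Plane geometry in an orthonormal frame\<close>

text \<open>Coordinates in an orthonormal frame, kept abstract so that the frame can be turned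
  towards \<open>p\<close> without moving \<open>S\<close>.\<close>

locale frame =
  fixes X Y :: "point \<Rightarrow> real"
  assumes linX: "linear X" and linY: "linear Y"
    and norm_frame: "(norm v)\<^sup>2 = (X v)\<^sup>2 + (Y v)\<^sup>2"
begin

lemmas X_simps = linear_add[OF linX] linear_diff[OF linX] linear_neg[OF linX] linear_scale[OF linX]
lemmas Y_simps = linear_add[OF linY] linear_diff[OF linY] linear_neg[OF linY] linear_scale[OF linY]
lemmas frame_simps = X_simps Y_simps

lemma frame_eqI:
  assumes "X u = X v" "Y u = Y v"
  shows "u = v"
proof -
  have "(norm (u - v))\<^sup>2 = 0" unfolding norm_frame using assms by (simp add: frame_simps)
  then show ?thesis by simp
qed

lemma norm_frame_sqrt: "norm v = sqrt ((X v)\<^sup>2 + (Y v)\<^sup>2)"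
  by (simp flip: norm_frame)

lemma inner_frame: "inner u v = X u * X v + Y u * Y v"
  unfolding dot_norm norm_frame by (simp add: frame_simps power2_eq_square algebra_simps)

lemma inner_le_norm: "cos t * X v + sin t * Y v \<le> norm v"
proof -
  have lagrange: "(c * x + s * y)\<^sup>2 + (c * y - s * x)\<^sup>2 = (c\<^sup>2 + s\<^sup>2) * (x\<^sup>2 + y\<^sup>2)"
    for c s x y :: real
    by (simp add: power2_eq_square algebra_simps)
  have "(cos t * X v + sin t * Y v)\<^sup>2 \<le> ((cos t)\<^sup>2 + (sin t)\<^sup>2) * ((X v)\<^sup>2 + (Y v)\<^sup>2)"
    unfolding lagrange[symmetric] by simp
  then have "(cos t * X v + sin t * Y v)\<^sup>2 \<le> (norm v)\<^sup>2"
    by (simp add: norm_frame)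
  then show ?thesis by (rule power2_le_imp_le) simp
qed

text \<open>Twice the signed area of the triangle; positive when the triangle is counterclockwise.\<close>

definition orient :: "point \<Rightarrow> point \<Rightarrow> point \<Rightarrow> real" where
  "orient a b c = (X b - X a) * (Y c - Y a) - (Y b - Y a) * (X c - X a)"

lemma orient_rotate: "orient a b c = orient b c a"
  by (simp add: orient_def algebra_simps)

lemma orient_swap: "orient a b c = - orient b a c"
  by (simp add: orient_def algebra_simps)

lemma orient_uminus: "orient (- a) (- b) (- c) = orient a b c"
  by (simp add: orient_def frame_simps algebra_simps)

lemma orient_convex:
  assumes "s + t = 1"
  shows "orient a b (s *\<^sub>R c + t *\<^sub>R d) = s * orient a b c + t * orient a b d"
proof -
  have "s = 1 - t" using assms by simp
  show ?thesis unfolding \<open>s = 1 - t\<close> by (simp add: orient_def frame_simps algebra_simps)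
qed

text \<open>\<open>orient a b\<close> is affine and vanishes on the line \<open>a b\<close>. At a
  common point it is a convex combination of the nonnegative values at \<open>c\<close> and
  \<open>d\<close>, so all weight sits on points with value zero, and these are endpoints of the
  first segment.\<close>

lemma segments_meet_at_endpoint:
  assumes c: "orient a b c \<ge> 0" "orient a b c = 0 \<Longrightarrow> c \<in> {a, b}"
    and d: "orient a b d \<ge> 0" "orient a b d = 0 \<Longrightarrow> d \<in> {a, b}"
    and ne: "{a, b} \<noteq> {c, d}" and "c \<noteq> d"
  shows "convex hull {a, b} \<inter> convex hull {c, d} \<subseteq> {a, b} \<inter> {c, d}"
proof
  fix z assume "z \<in> convex hull {a, b} \<inter> convex hull {c, d}"
  then obtain s t s' t' where st: "z = s *\<^sub>R a + t *\<^sub>R b" "s + t = 1"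
    and st': "z = s' *\<^sub>R c + t' *\<^sub>R d" "s' \<ge> 0" "t' \<ge> 0" "s' + t' = 1"
    unfolding convex_hull_2 by blast
  have "orient a b z = 0"
    unfolding st(1) orient_convex[OF st(2)] by (simp add: orient_def)
  then have "s' * orient a b c + t' * orient a b d = 0"
    unfolding st'(1) orient_convex[OF st'(4)] .
  then have *: "s' * orient a b c = 0" "t' * orient a b d = 0"
    using st' c d by (auto simp: add_nonneg_eq_0_iff)
  then consider "c \<in> {a,b}" "t' = 0" | "d \<in> {a, b}" "s' = 0" | "c \<in> {a,b}" "d \<in> {a,b}"
    using c(2) d(2) st'(4) by fastforce
  then show "z \<in> {a, b} \<inter> {c, d}"
  proof cases
    case 1
    then have "z = c" using st' by simp
    then show ?thesis using 1 by blast
  next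
    case 2
    then have "z = d" using st' by simp
    then show ?thesis using 2 by blast
  next
    case 3
    then show ?thesis using ne \<open>c \<noteq> d\<close> by blast
  qed
qed

lemma segments_meet_at_endpoint':
  assumes "orient a b c \<le> 0" "orient a b c = 0 \<Longrightarrow> c \<in> {a, b}"
    and "orient a b d \<le> 0" "orient a b d = 0 \<Longrightarrow> d \<in> {a, b}"
    and "{a, b} \<noteq> {c, d}" "c \<noteq> d"
  shows "convex hull {a, b} \<inter> convex hull {c, d} \<subseteq> {a, b} \<inter> {c, d}"
  using segments_meet_at_endpoint[of b a c d] assms
  by (simp add: orient_swap[of b a] insert_commute)

text \<open>The signs make \<open>u v\<close> and \<open>a b\<close> cross at a point
  \<open>z\<close>; then add the triangle inequalities for \<open>u, z, a\<close> and
  \<open>b, z, v\<close>.\<close>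

lemma crossing_diagonals:
  assumes "orient u v a > 0" "orient u v b < 0" "orient a b u < 0" "orient a b v > 0"
  shows "dist u a + dist b v \<le> dist u v + dist a b"
proof -
  \<comment> \<open>\<open>D\<close> is the determinant in Cramer's rule for the crossing point, and
    \<open>s\<close>, \<open>t\<close> are its parameters on \<open>u v\<close> and
    \<open>a b\<close>. They lie in [0, 1] since \<open>D\<close> is a sum of two positive terms in
    two ways.\<close>
  define D where "D = orient u v a - orient u v b"
  have D: "D = orient a b v - orient a b u" "D > 0"
    using assms by (auto simp: D_def orient_def algebra_simps)
  define s t where "s = - orient a b u / D" and "t = orient u v a / D"
  have s: "0 \<le> s" "s \<le> 1" "0 \<le> t" "t \<le> 1"
    using assms D by (auto simp: s_def t_def D_def divide_simps)
  define z where "z = u + s *\<^sub>R (v - u)"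
  have sD: "D * s = - orient a b u" "D * t = orient u v a" using D(2) by (auto simp: s_def t_def)
  have XX: "D * X (c + k *\<^sub>R (d - c)) = D * X c + (D * k) * (X d - X c)" for c d k
    by (simp add: frame_simps algebra_simps)
  have YY: "D * Y (c + k *\<^sub>R (d - c)) = D * Y c + (D * k) * (Y d - Y c)" for c d k
    by (simp add: frame_simps algebra_simps)
  have eqX: "D * X (u + s *\<^sub>R (v - u)) = D * X (a + t *\<^sub>R (b - a))"
    unfolding XX sD by (simp add: D_def orient_def algebra_simps)
  have eqY: "D * Y (u + s *\<^sub>R (v - u)) = D * Y (a + t *\<^sub>R (b - a))"
    unfolding YY sD by (simp add: D_def orient_def algebra_simps)
  have "D \<noteq> 0" using D(2) by simp
  then have z: "z = a + t *\<^sub>R (b - a)" unfolding z_def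
    by (intro frame_eqI iffD1[OF mult_left_cancel eqX] iffD1[OF mult_left_cancel eqY])
  have "z = (1 - s) *\<^sub>R u + s *\<^sub>R v" by (simp add: z_def scaleR_diff_left scaleR_diff_right)
  then have "z \<in> closed_segment u v" unfolding in_segment using s by blast
  moreover have "z = (1 - t) *\<^sub>R a + t *\<^sub>R b" by (simp add: z scaleR_diff_left scaleR_diff_right)
  then have "z \<in> closed_segment a b" unfolding in_segment using s by blast
  ultimately have "dist u v = dist u z + dist z v" "dist a b = dist a z + dist z b"
    by (metis between between_mem_segment)+
  then show ?thesis
    using dist_triangle[of u a z] dist_triangle[of b v z] dist_commute[of a z] dist_commute[of b z]
    by linarith
qed

text \<open>Averaging over all directions, the length of a chain is half the integral over
  \<open>[0, \<pi>]\<close> of the total variation of its projections; each projection is unimodal and its peak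
  lies in the disc with diameter \<open>w a w b\<close>, so the variation is at most the diameter.\<close>

lemma chain_length:
  assumes ab: "a \<le> b"
    and incr: "\<And>i. a \<le> i \<Longrightarrow> i < b \<Longrightarrow> X (w i) < X (w (Suc i))"
    and conc: "\<And>i. a \<le> i \<Longrightarrow> Suc i < b \<Longrightarrow> orient (w i) (w (Suc i)) (w (Suc (Suc i))) \<le> 0"
    and obt: "\<And>i. a \<le> i \<Longrightarrow> i \<le> b \<Longrightarrow> inner (w a - w i) (w b - w i) \<le> 0"
  shows "(\<Sum>i=a..<b. dist (w i) (w (Suc i))) \<le> pi / 2 * dist (w a) (w b)"
proof -
  let ?g = "\<lambda>i t. \<bar>cos t * X (w (Suc i) - w i) + sin t * Y (w (Suc i) - w i)\<bar>"
  \<comment> \<open>Thales: the nonpositive inner product at \<open>w i\<close> puts it in the disc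
    with diameter \<open>w a\<close>, \<open>w b\<close>.\<close>
  have disc: "2 * norm (w i - midpoint (w a) (w b)) \<le> dist (w a) (w b)" if "a \<le> i" "i \<le> b" for i
  proof -
    define x y where "x = w a - w i" and "y = w b - w i"
    have "w i - midpoint (w a) (w b) = (- 1/2) *\<^sub>R (x + y)"
      by (rule frame_eqI; simp only: midpoint_def frame_simps; simp add: x_def y_def frame_simps field_simps)
    then have centre: "2 * norm (w i - midpoint (w a) (w b)) = norm (x + y)" by simp
    have "(norm (x + y))\<^sup>2 = (norm (x - y))\<^sup>2 + 4 * inner x y"
      using dot_norm[of x y] dot_norm_neg[of x y] by (simp add: field_simps)
    moreover have "inner x y \<le> 0" using obt[OF that] by (simp only: x_def y_def)
    ultimately have "(norm (x + y))\<^sup>2 \<le> (norm (x - y))\<^sup>2" by linarith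
    then have "norm (x + y) \<le> norm (x - y)" by (rule power2_le_imp_le) simp
    moreover have "x - y = w a - w b" by (simp add: x_def y_def)
    ultimately show ?thesis unfolding centre by (simp only: dist_norm)
  qed
  have "((\<lambda>t. \<Sum>i=a..<b. ?g i t) has_integral (\<Sum>i=a..<b. 2 * dist (w i) (w (Suc i)))) {0..pi}"
  proof (rule has_integral_sum)
    fix i assume "i \<in> {a..<b}"
    then have "0 < X (w (Suc i) - w i)" using incr[of i] by (simp add: frame_simps)
    from crofton_integral[OF this, of "Y (w (Suc i) - w i)"]
    moreover have "dist (w i) (w (Suc i)) = norm (w (Suc i) - w i)"
      by (simp only: dist_norm norm_minus_commute)
    ultimately show "(?g i has_integral 2 * dist (w i) (w (Suc i))) {0..pi}"
      by (simp only: norm_frame_sqrt)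
  qed simp
  moreover have "((\<lambda>t. dist (w a) (w b)) has_integral pi * dist (w a) (w b)) {0..pi}"
    using has_integral_const_real[of "dist (w a) (w b)" 0 pi] by simp
  moreover have "(\<Sum>i=a..<b. ?g i t) \<le> dist (w a) (w b)" if t: "t \<in> {0..pi}" for t
  proof -
    define h where "h v = cos t * X v + sin t * Y v" for v
    have h_diff: "h (u - v) = h u - h v" for u v by (simp add: h_def frame_simps algebra_simps)
    have g: "?g i t = \<bar>h (w (Suc i)) - h (w i)\<bar>" for i
      unfolding h_diff[symmetric] unfolding h_def by simp
    have sin: "sin t \<ge> 0" using t by (simp add: sin_ge_zero)
    have peak: "h (w (Suc (Suc i))) \<le> h (w (Suc i))"
      if i: "a \<le> i" "Suc i < b" "h (w (Suc i)) \<le> h (w i)" for i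
    proof -
      define x1 x2 where "x1 = X (w (Suc i)) - X (w i)" and "x2 = X (w (Suc (Suc i))) - X (w (Suc i))"
      have x: "x1 > 0" "x2 > 0" using incr[of i] incr[of "Suc i"] i by (auto simp: x1_def x2_def)
      \<comment> \<open>Concavity passes to \<open>h\<close>: over \<open>X\<close> its slope is
        \<open>cos t\<close> plus \<open>sin t\<close> times the slope of the chain, with
        \<open>sin t\<close> nonnegative. The identity compares consecutive slopes with denominators
        cleared.\<close>
      have "x1 * (h (w (Suc (Suc i))) - h (w (Suc i))) =
        x2 * (h (w (Suc i)) - h (w i)) + sin t * orient (w i) (w (Suc i)) (w (Suc (Suc i)))"
        by (simp add: h_def x1_def x2_def orient_def algebra_simps)
      also have "\<dots> \<le> 0"
        using conc[OF i(1,2)] sin i(3) x by (intro add_nonpos_nonpos mult_nonneg_nonpos) auto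
      finally show ?thesis using x by (simp add: mult_le_0_iff)
    qed
    obtain m where m: "m \<in> {a..b}"
      "(\<Sum>i=a..<b. \<bar>h (w (Suc i)) - h (w i)\<bar>) = 2 * h (w m) - h (w a) - h (w b)"
      using unimodal_variation[OF ab, of "\<lambda>i. h (w i)", OF peak] by blast
    have "(\<Sum>i=a..<b. ?g i t) = 2 * h (w m) - h (w a) - h (w b)"
      using m(2) by (simp only: g)
    \<comment> \<open>The variation is twice the height of the peak over the midpoint in direction
      \<open>t\<close>, hence at most the diameter of the disc.\<close>
    also have "\<dots> = 2 * h (w m - midpoint (w a) (w b))"
      unfolding h_diff by (simp add: h_def midpoint_def frame_simps field_simps)
    also have "\<dots> \<le> 2 * norm (w m - midpoint (w a) (w b))"
      unfolding h_def by (intro mult_left_mono inner_le_norm) simp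
    also have "\<dots> \<le> dist (w a) (w b)" using disc m(1) by simp
    finally show ?thesis .
  qed
  ultimately have "(\<Sum>i=a..<b. 2 * dist (w i) (w (Suc i))) \<le> pi * dist (w a) (w b)"
    by (rule has_integral_le)
  then show ?thesis by (simp flip: sum_distrib_left)
qed

end

section \<open>Hulls of centrally symmetric sets\<close>

locale symmetric_hull = frame +
  fixes S :: "point set" and p :: point and R :: real
  assumes fin: "finite S" and sym: "centrally_symmetric S" and conv: "convex_position S"
    and pS: "p \<in> S" and Xp: "X p = R" and Yp: "Y p = 0" and R0: "R > 0"
    and far: "v \<in> S \<Longrightarrow> norm v \<le> R"
begin

lemma minus_mem: "v \<in> S \<Longrightarrow> - v \<in> S"
  using sym by (simp add: centrally_symmetric_def)

lemma minus_p: "- p \<in> S" "X (- p) = - R" "Y (- p) = 0"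
  using minus_mem[OF pS] Xp Yp by (simp_all add: frame_simps)

lemma in_disc: "v \<in> S \<Longrightarrow> (X v)\<^sup>2 + (Y v)\<^sup>2 \<le> R\<^sup>2"
  using power_mono[OF far norm_ge_zero, of v 2] by (simp flip: norm_frame)

lemma abs_X_le: "v \<in> S \<Longrightarrow> \<bar>X v\<bar> \<le> R"
  using in_disc[of v] R0 zero_le_power2[of "Y v"] by (intro abs_le_square_iff[THEN iffD2, of "X v" R, simplified abs_of_pos[OF R0]]) linarith

text \<open>The disc of radius \<open>R\<close> touches the lines \<open>X v = R\<close> and
  \<open>X v = - R\<close> only at \<open>p\<close> and \<open>- p\<close>.\<close>

lemma extreme:
  assumes "v \<in> S"
  shows "X v = R \<Longrightarrow> v = p" "X v = - R \<Longrightarrow> v = - p"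
proof -
  have Y: "Y v = 0" if "(X v)\<^sup>2 = R\<^sup>2" using in_disc[OF assms] that by simp
  show "v = p" if "X v = R" using Y that Xp Yp by (intro frame_eqI) auto
  show "v = - p" if "X v = - R" using Y that minus_p by (intro frame_eqI) auto
qed

lemma strict_X:
  assumes "v \<in> S"
  shows "v \<noteq> - p \<Longrightarrow> - R < X v" "v \<noteq> p \<Longrightarrow> X v < R"
  using extreme[OF assms] abs_X_le[OF assms] by (force simp: abs_le_iff order_less_le)+

text \<open>A convex combination of \<open>p\<close> and \<open>- p\<close>, both of which survive
  the removal of \<open>a\<close>. It supplies the foot of a point on the axis as a hull
  point.\<close>

lemma axis_in_hull:
  assumes "a \<noteq> p" "a \<noteq> - p" "\<bar>x\<bar> \<le> R"
  shows "(x / R) *\<^sub>R p \<in> convex hull (S - {a})"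
proof -
  have "((R + x) / (2 * R)) *\<^sub>R p + ((R - x) / (2 * R)) *\<^sub>R (- p) \<in> convex hull (S - {a})"
    using assms R0 pS minus_p(1)
    by (intro convexD[OF convex_convex_hull] hull_inc) (auto simp: field_simps)
  also have "((R + x) / (2 * R)) *\<^sub>R p + ((R - x) / (2 * R)) *\<^sub>R (- p) = (x / R) *\<^sub>R p"
    using R0 by (intro frame_eqI) (simp_all add: frame_simps field_simps)
  finally show ?thesis .
qed

text \<open>Otherwise \<open>a\<close> would lie on the vertical segment from its foot
  \<open>f\<close> on the axis to \<open>d\<close>, hence in the hull of the other points, against
  convex position.\<close>

lemma not_below_hull:
  assumes a: "a \<in> S" "a \<noteq> p" "a \<noteq> - p" "0 \<le> Y a"
    and d: "d \<in> convex hull (S - {a})" "X d = X a"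
  shows "Y d < Y a"
proof (rule ccontr)
  assume "\<not> Y d < Y a"
  then have le: "Y a \<le> Y d" by simp
  define f where "f = (X a / R) *\<^sub>R p"
  have f: "f \<in> convex hull (S - {a})" "X f = X a" "Y f = 0"
    using axis_in_hull[OF a(2,3) abs_X_le[OF a(1)]] Xp Yp R0 by (auto simp: f_def frame_simps)
  have "a \<in> convex hull (S - {a})"
  proof (cases "Y d = 0")
    case True
    then have "d = a" using le a(4) d(2) by (intro frame_eqI) auto
    then show ?thesis using d by simp
  next
    case False
    define t where "t = Y a / Y d"
    have t: "0 \<le> t" "t \<le> 1" "t * Y d = Y a" using False le a(4) by (auto simp: t_def divide_le_eq)
    have "a = (1 - t) *\<^sub>R f + t *\<^sub>R d"
      using f(2,3) d(2) t(3) by (intro frame_eqI) (simp_all add: frame_simps algebra_simps)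
    moreover have "(1 - t) *\<^sub>R f + t *\<^sub>R d \<in> convex hull (S - {a})"
      using t f d by (intro convexD[OF convex_convex_hull]) auto
    ultimately show ?thesis by simp
  qed
  then show False using conv a(1) by (simp add: convex_position_def)
qed

lemma on_axis:
  assumes "a \<in> S" "Y a = 0"
  shows "a = p \<or> a = - p"
proof (rule ccontr)
  assume "\<not> (a = p \<or> a = - p)"
  then have a: "a \<noteq> p" "a \<noteq> - p" by auto
  show False
    using not_below_hull[OF assms(1) a _ axis_in_hull[OF a abs_X_le[OF assms(1)]]] assms(2) R0 Xp Yp
    by (simp add: frame_simps)
qed

text \<open>Of two upper points on one vertical line, the higher would be a hull point not below the
  lower. This lets the upper chain be sorted by \<open>X\<close>.\<close>

lemma X_inj_upper: "inj_on X {v \<in> S. 0 \<le> Y v}"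
proof -
  have *: "a = b" if ab: "a \<in> S" "0 \<le> Y a" "b \<in> S" "X a = X b" "Y a \<le> Y b" for a b
  proof (rule ccontr)
    assume "a \<noteq> b"
    moreover from this have "a \<noteq> p" "a \<noteq> - p"
      using extreme[OF ab(3)] ab(4) Xp minus_p(2) by auto
    ultimately show False
      using not_below_hull[of a b] ab by (simp add: hull_inc)
  qed
  show ?thesis
    by (rule inj_onI) (use * in \<open>metis (mono_tags, lifting) linear mem_Collect_eq\<close>)
qed

text \<open>Let \<open>d\<close> be the point of the chord \<open>a c\<close> on the vertical line
  through \<open>b\<close>. It lies in the hull of the other points, hence below \<open>b\<close>,
  and \<open>orient a b c\<close> is \<open>Y d - Y b\<close> times a positive width.\<close>

lemma upper_concave:
  assumes S: "a \<in> S" "b \<in> S" "c \<in> S" and Y: "0 \<le> Y b" and X: "X a < X b" "X b < X c"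
  shows "orient a b c < 0"
proof -
  define t where "t = (X b - X a) / (X c - X a)"
  have t: "0 \<le> t" "t \<le> 1" "t * (X c - X a) = X b - X a" using X by (auto simp: t_def divide_le_eq)
  define d where "d = (1 - t) *\<^sub>R a + t *\<^sub>R c"
  have Xd: "X d = X b" using t(3) by (simp add: d_def frame_simps algebra_simps)
  have "(X c - X a) * (Y d - Y b) = (t * (X c - X a)) * (Y c - Y a) - (Y b - Y a) * (X c - X a)"
    by (simp add: d_def frame_simps algebra_simps)
  also have "\<dots> = orient a b c" unfolding t(3) by (simp add: orient_def)
  finally have or: "orient a b c = (X c - X a) * (Y d - Y b)" by simp
  have "d \<in> convex hull (S - {b})"
    unfolding d_def using t S X by (intro convexD[OF convex_convex_hull] hull_inc) auto
  moreover have "b \<noteq> p" "b \<noteq> - p" using X Xp minus_p(2) abs_X_le[OF S(1)] abs_X_le[OF S(3)] by auto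
  ultimately have "Y d < Y b" using not_below_hull[OF S(2) _ _ Y _ Xd] by blast
  then show ?thesis using X by (simp add: or mult_pos_neg)
qed

lemma chord_above_ends:
  assumes "u \<in> S" "a \<in> S" "0 \<le> Y u" "0 \<le> Y a" "X u < X a"
  shows "orient u a (- p) \<le> 0" "orient u a p \<le> 0"
proof -
  show "orient u a (- p) \<le> 0"
  proof (cases "u = - p")
    case False
    then have "X (- p) < X u" using strict_X(1)[OF assms(1)] minus_p by simp
    then have "orient (- p) u a < 0" using upper_concave[of "- p" u a] assms minus_p by auto
    then show ?thesis by (simp add: orient_rotate[of "- p"])
  qed (simp add: orient_def)
  show "orient u a p \<le> 0"
  proof (cases "a = p")
    case False
    then have "X a < X p" using strict_X(2)[OF assms(2)] Xp by simp
    then show ?thesis using upper_concave[of u a p] assms pS Yp by auto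
  qed (simp add: orient_def)
qed

text \<open>Both ends of the axis lie on or below the line \<open>u a\<close>, so the foot
  \<open>f\<close> of \<open>v\<close> does as well, and \<open>v\<close> is strictly below its
  foot.\<close>

lemma orient_upper_lower:
  assumes "u \<in> S" "a \<in> S" "0 \<le> Y u" "0 \<le> Y a" "X u < X a" and v: "v \<in> S" "Y v < 0"
  shows "orient u a v < 0"
proof -
  define s t where "s = (R - X v) / (2 * R)" and "t = (R + X v) / (2 * R)"
  have st: "s + t = 1" "s \<ge> 0" "t \<ge> 0"
    using abs_X_le[OF v(1)] R0 by (auto simp: s_def t_def field_simps)
  define f where "f = s *\<^sub>R (- p) + t *\<^sub>R p"
  have "X f = X v" "Y f = 0"
    using R0 Xp Yp by (simp_all add: f_def s_def t_def frame_simps field_simps)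
  then have "orient u a v = orient u a f + (X a - X u) * Y v"
    by (simp add: orient_def algebra_simps)
  moreover have "orient u a f \<le> 0"
    unfolding f_def orient_convex[OF st(1)]
    using chord_above_ends[OF assms(1-5)] st by (intro add_nonpos_nonpos mult_nonneg_nonpos)
  moreover have "(X a - X u) * Y v < 0" using assms(5) v by (simp add: mult_pos_neg)
  ultimately show ?thesis by linarith
qed

text \<open>By concavity the angle at \<open>w\<close> contains the angle under which \<open>w\<close> sees the diameter from
  \<open>- p\<close> to \<open>p\<close>, which is obtuse because \<open>w\<close> lies in the disc with that diameter.\<close>

lemma obtuse:
  assumes S: "u \<in> S" "w \<in> S" "v \<in> S" and Y: "0 \<le> Y u" "0 \<le> Y w" "0 \<le> Y v"
    and X: "X u < X w" "X w < X v"
  shows "inner (u - w) (v - w) \<le> 0"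
proof -
  define \<alpha> \<beta> a b where "\<alpha> = X w - X u" and "\<beta> = X v - X w" and "a = Y w - Y u" and "b = Y v - Y w"
  define P Q where "P = X w + R" and "Q = R - X w"
  have pos: "\<alpha> > 0" "\<beta> > 0" "P > 0" "Q > 0"
    using X abs_X_le[OF S(1)] abs_X_le[OF S(3)] by (auto simp: \<alpha>_def \<beta>_def P_def Q_def)
  \<comment> \<open>In slopes: \<open>u\<close> to \<open>w\<close> rises no more steeply than
    \<open>- p\<close> to \<open>w\<close>, and \<open>w\<close> to \<open>v\<close> falls no more
    steeply than \<open>w\<close> to \<open>p\<close>.\<close>
  have l: "a * P \<le> \<alpha> * Y w"
    using chord_above_ends(1)[OF S(1,2) Y(1,2) X(1)] minus_p
    by (simp add: orient_def \<alpha>_def a_def P_def algebra_simps)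
  have r: "- b * Q \<le> \<beta> * Y w"
    using chord_above_ends(2)[OF S(2,3) Y(2,3) X(2)] Xp Yp
    by (simp add: orient_def \<beta>_def b_def Q_def algebra_simps)
  have m: "\<alpha> * b \<le> \<beta> * a"
    using upper_concave[OF S Y(2) X] by (simp add: orient_def \<alpha>_def \<beta>_def a_def b_def algebra_simps)
  have "P * Q = R\<^sup>2 - (X w)\<^sup>2" by (simp add: P_def Q_def power2_eq_square algebra_simps)
  then have disc: "(Y w)\<^sup>2 \<le> P * Q" using in_disc[OF S(2)] by simp
  \<comment> \<open>Only a negative \<open>a * b\<close> matters. A valley is excluded by
    \<open>m\<close>; at a peak the product of the two slope bounds is combined with
    \<open>(Y w)\<^sup>2 \<le> P * Q\<close>.\<close>
  have "- (a * b) \<le> \<alpha> * \<beta>"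
  proof (cases "a > 0 \<and> b < 0")
    case True
    have "(a * P) * (- b * Q) \<le> (\<alpha> * Y w) * (\<beta> * Y w)"
      using pos True Y by (intro mult_mono[OF l r] mult_nonneg_nonneg) auto
    also have "\<dots> = (\<alpha> * \<beta>) * (Y w)\<^sup>2" by (simp add: power2_eq_square)
    also have "\<dots> \<le> (\<alpha> * \<beta>) * (P * Q)" using disc pos by (intro mult_left_mono) auto
    finally have "- (a * b) * (P * Q) \<le> (\<alpha> * \<beta>) * (P * Q)" by (simp add: mult_ac)
    then show ?thesis using pos by (simp only: mult_le_cancel_right_pos[OF mult_pos_pos[OF pos(3,4)]])
  next
    case False
    have "a * b \<ge> 0"
    proof (cases "a > 0")
      case True
      then show ?thesis using False by simp
    next
      case a: False
      then have "\<beta> * a \<le> 0" using pos by (simp add: mult_nonneg_nonpos)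
      then have "\<alpha> * b \<le> 0" using m by linarith
      then have "b \<le> 0" using pos by (simp add: mult_le_0_iff)
      then show ?thesis using a by (simp add: mult_nonpos_nonpos)
    qed
    moreover have "\<alpha> * \<beta> > 0" using pos by simp
    ultimately show ?thesis by linarith
  qed
  moreover have "inner (u - w) (v - w) = - (\<alpha> * \<beta>) - a * b"
    by (simp add: inner_frame frame_simps \<alpha>_def \<beta>_def a_def b_def algebra_simps)
  ultimately show ?thesis by linarith
qed

end

section \<open>Enumeration of the hull vertices and the hull edges\<close>

text \<open>One enumeration serves both chains: \<open>w\<close> runs along the upper one from
  \<open>- p\<close> to \<open>p\<close>, and \<open>- w\<close> covers the lower one. As
  \<open>- w 0 = w n\<close> and \<open>- w n = w 0\<close>, points strictly below the axis have
  indices strictly between 0 and \<open>n\<close>.\<close>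

locale hull_order = symmetric_hull +
  fixes w :: "nat \<Rightarrow> point" and n :: nat
  assumes w_mono: "i < j \<Longrightarrow> j \<le> n \<Longrightarrow> X (w i) < X (w j)"
    and w_image: "w ` {..n} = {v \<in> S. 0 \<le> Y v}"
begin

lemma w_mem: "i \<le> n \<Longrightarrow> w i \<in> S" "i \<le> n \<Longrightarrow> 0 \<le> Y (w i)"
  using w_image by (auto simp: set_eq_iff)

lemma upper_index:
  assumes "v \<in> S" "0 \<le> Y v"
  obtains i where "i \<le> n" "v = w i"
proof -
  have "v \<in> w ` {..n}" unfolding w_image using assms by simp
  then show ?thesis using that by blast
qed

lemma w_inj: "i \<le> n \<Longrightarrow> j \<le> n \<Longrightarrow> w i = w j \<longleftrightarrow> i = j"
  using w_mono[of i j] w_mono[of j i] by (cases i j rule: linorder_cases) auto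

lemma w_ends: "w 0 = - p" "w n = p" "0 < n"
proof -
  obtain i where i: "i \<le> n" "- p = w i" using upper_index[of "- p"] minus_p by auto
  obtain j where j: "j \<le> n" "p = w j" using upper_index[of p] pS Yp by auto
  show 0: "w 0 = - p"
    using w_mono[of 0 i] i minus_p(2) abs_X_le[OF w_mem(1), of 0] by (cases "i = 0") auto
  show n: "w n = p"
    using w_mono[of j n] j Xp abs_X_le[OF w_mem(1), of n] by (cases "j = n") auto
  show "0 < n"
  proof (rule gr0I)
    assume "n = 0"
    then have "w 0 = w n" by simp
    then have "X (- p) = X p" unfolding 0 n by (rule arg_cong)
    then show False using Xp minus_p(2) R0 by simp
  qed
qed

lemma w_interior: "0 < k \<Longrightarrow> k < n \<Longrightarrow> 0 < Y (w k)"
  using on_axis[of "w k"] w_mem[of k] w_ends w_inj[of k 0] w_inj[of k n] by fastforce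

lemma w_neq_minus_w: "i \<le> n \<Longrightarrow> 0 < j \<Longrightarrow> j < n \<Longrightarrow> w i \<noteq> - w j"
  using w_mem[of i] w_interior[of j] by (auto simp: frame_simps)

lemma orient_w: "i < j \<Longrightarrow> j < k \<Longrightarrow> k \<le> n \<Longrightarrow> orient (w i) (w j) (w k) < 0"
  using upper_concave[of "w i" "w j" "w k"] w_mem w_mono by simp

lemma orient_w_minus:
  assumes "i < j" "j \<le> n" "0 < k" "k < n"
  shows "orient (w i) (w j) (- w k) < 0"
  using orient_upper_lower[of "w i" "w j" "- w k"] w_mem[of i] w_mem[of j] w_mem[of k] w_mono[of i j]
    minus_mem[of "w k"] w_interior[of k] assms by (simp add: frame_simps)

text \<open>Reflection in the origin preserves orientation, so this mirrors
  \<open>orient_w_minus\<close>; \<open>w 0 = - w n\<close> and \<open>w n = - w 0\<close>, which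
  lie on both chains, reduce to \<open>orient_w\<close>.\<close>

lemma orient_minus_w:
  assumes "i < j" "0 < i" "j < n" "k \<le> n"
  shows "orient (- w i) (- w j) (w k) < 0"
proof -
  consider "k = 0" | "k = n" | "0 < k" "k < n" using assms by linarith
  then show ?thesis
  proof cases
    case 1
    then have "w k = - w n" using w_ends by simp
    then show ?thesis using orient_w[of i j n] assms by (simp add: orient_uminus)
  next
    case 2
    then have "w k = - w 0" using w_ends by simp
    then show ?thesis
      using orient_w[of 0 i j] assms by (simp add: orient_uminus orient_rotate[of "w 0"])
  next
    case 3
    then show ?thesis using orient_w_minus[of i j k] assms orient_uminus[of "w i" "w j" "- w k"] by simp
  qed
qed

definition upper_edges :: "point set set" where
  "upper_edges = (\<lambda>i. {w i, w (Suc i)}) ` {..<n}"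

definition lower_edges :: "point set set" where
  "lower_edges = (\<lambda>i. {- w i, - w (Suc i)}) ` {..<n}"

text \<open>No index lies strictly between \<open>i\<close> and \<open>Suc i\<close>, so concavity
  covers all other upper points; \<open>orient_upper_lower\<close> covers the lower ones.\<close>

lemma upper_edge_supports:
  assumes "i < n" "s \<in> S"
  shows "orient (w i) (w (Suc i)) s \<le> 0 \<and>
    (orient (w i) (w (Suc i)) s = 0 \<longrightarrow> s \<in> {w i, w (Suc i)})"
proof (cases "0 \<le> Y s")
  case True
  then obtain k where k: "k \<le> n" "s = w k" using upper_index assms by blast
  consider "k < i" | "k = i" | "k = Suc i" | "Suc i < k" by linarith
  then show ?thesis
  proof cases
    case 1
    then show ?thesis using orient_w[of k i "Suc i"] assms k orient_rotate[of "w k"] by simp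
  next
    case 4
    then show ?thesis using orient_w[of i "Suc i" k] k by simp
  qed (auto simp: k(2) orient_def)
next
  case False
  then show ?thesis
    using orient_upper_lower[of "w i" "w (Suc i)" s] w_mem w_mono[of i "Suc i"] assms by simp
qed

text \<open>The line through a chain edge supports \<open>S\<close>, so no segment between points of
  \<open>S\<close> crosses that edge; lower edges reduce to upper ones by reflection.\<close>

lemma hull_edge_plane:
  assumes "e \<in> upper_edges \<union> lower_edges" "c \<in> S" "d \<in> S" "c \<noteq> d" "e \<noteq> {c, d}"
  shows "convex hull e \<inter> convex hull {c, d} \<subseteq> e \<inter> {c, d}"
proof -
  consider i where "i < n" "e = {w i, w (Suc i)}" | i where "i < n" "e = {- w i, - w (Suc i)}"
    using assms(1) by (auto simp: upper_edges_def lower_edges_def)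
  then show ?thesis
  proof cases
    case (1 i)
    show ?thesis unfolding 1
      using upper_edge_supports[OF 1(1) assms(2)] upper_edge_supports[OF 1(1) assms(3)] assms(4,5) 1(2)
      by (intro segments_meet_at_endpoint') auto
  next
    case (2 i)
    have *: "orient (- w i) (- w (Suc i)) s \<le> 0 \<and>
      (orient (- w i) (- w (Suc i)) s = 0 \<longrightarrow> s \<in> {- w i, - w (Suc i)})" if "s \<in> S" for s
      using upper_edge_supports[OF 2(1) minus_mem[OF that]] orient_uminus[of "w i" "w (Suc i)" "- s"]
      by (auto simp: minus_equation_iff[of s] equation_minus_iff[of s])
    show ?thesis unfolding 2
      using *[OF assms(2)] *[OF assms(3)] assms(4,5) 2(2)
      by (intro segments_meet_at_endpoint') auto
  qed
qed

text \<open>Clockwise, \<open>w i'\<close> and \<open>- w j'\<close> come after \<open>w i\<close>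
  and before \<open>- w j\<close>, so both lie strictly on one side of the first edge.\<close>

lemma matching_edges_plane:
  assumes "i < i'" "i' \<le> n" "j' < j" "0 < j'" "j < n"
  shows "convex hull {w i, - w j} \<inter> convex hull {w i', - w j'} \<subseteq> {w i, - w j} \<inter> {w i', - w j'}"
proof (rule segments_meet_at_endpoint)
  have "orient (w i) (w i') (- w j) < 0" using orient_w_minus assms by simp
  then have c: "orient (w i) (- w j) (w i') > 0"
    by (metis orient_rotate orient_swap neg_less_0_iff_less)
  have "orient (- w j') (- w j) (w i) < 0" using orient_minus_w assms by simp
  then have d: "orient (w i) (- w j) (- w j') > 0"
    by (metis orient_rotate orient_swap neg_less_0_iff_less)
  show "orient (w i) (- w j) (w i') \<ge> 0" "orient (w i) (- w j) (- w j') \<ge> 0" using c d by auto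
  show "w i' \<in> {w i, - w j}" if "orient (w i) (- w j) (w i') = 0" using c that by simp
  show "- w j' \<in> {w i, - w j}" if "orient (w i) (- w j) (- w j') = 0" using d that by simp
  show "{w i, - w j} \<noteq> {w i', - w j'}"
    using w_neq_minus_w[of i j'] w_inj[of i i'] assms by (auto simp: doubleton_eq_iff)
  show "w i' \<noteq> - w j'" using w_neq_minus_w assms by simp
qed

lemma upper_chain_walk:
  assumes "i \<le> n" "j \<le> n"
  shows "\<exists>l \<le> pi / 2 * dist (w i) (w j). walk upper_edges l (w i) (w j)"
proof -
  have *: "\<exists>l \<le> pi / 2 * dist (w i) (w j). walk upper_edges l (w i) (w j)" if "i \<le> j" "j \<le> n" for i j
  proof -
    have "(\<Sum>k=i..<j. dist (w k) (w (Suc k))) \<le> pi / 2 * dist (w i) (w j)"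
    proof (rule chain_length[OF that(1)])
      fix k assume k: "i \<le> k" "k < j"
      then show "X (w k) < X (w (Suc k))" using w_mono that by simp
    next
      fix k assume k: "i \<le> k" "Suc k < j"
      then show "orient (w k) (w (Suc k)) (w (Suc (Suc k))) \<le> 0"
        using orient_w[of k "Suc k" "Suc (Suc k)"] that by simp
    next
      fix k assume k: "i \<le> k" "k \<le> j"
      then consider "k = i" | "k = j" | "i < k" "k < j" by linarith
      then show "inner (w i - w k) (w j - w k) \<le> 0"
        by cases (use obtuse[of "w i" "w k" "w j"] w_mem w_mono that in auto)
    qed
    moreover have "walk upper_edges (\<Sum>k=i..<j. dist (w k) (w (Suc k))) (w i) (w j)"
      using that by (intro walk_chain) (auto simp: upper_edges_def)
    ultimately show ?thesis by blast
  qed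
  show ?thesis
  proof (cases "i \<le> j")
    case True
    then show ?thesis using * assms by blast
  next
    case False
    then obtain l where "l \<le> pi / 2 * dist (w j) (w i)" "walk upper_edges l (w j) (w i)"
      using *[of j i] assms by auto
    then show ?thesis using walk_sym by (metis dist_commute)
  qed
qed

lemma lower_chain_walk:
  assumes "i \<le> n" "j \<le> n"
  shows "\<exists>l \<le> pi / 2 * dist (- w i) (- w j). walk lower_edges l (- w i) (- w j)"
proof -
  have reflect: "walk lower_edges l (- u) (- v)" if "walk upper_edges l u v" for l u v
    using that
  proof (induction rule: walk.induct)
    case (refl u)
    show ?case by (rule walk.refl)
  next
    case (step u x l v)
    have "{- u, - x} \<in> lower_edges"
      using step.hyps(1) by (auto simp: upper_edges_def lower_edges_def doubleton_eq_iff)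
    from walk.step[OF this step.IH] show ?case by (simp add: dist_minus)
  qed
  then show ?thesis using upper_chain_walk[OF assms] by (fastforce simp: dist_minus)
qed

end

context symmetric_hull
begin

text \<open>Sort the \<open>X\<close> values of the upper points and invert \<open>X\<close>, which
  is injective there.\<close>

lemma exists_hull_order: "\<exists>w n. hull_order X Y S p R w n"
proof -
  define U where "U = {v \<in> S. 0 \<le> Y v}"
  define l where "l = sorted_list_of_set (X ` U)"
  define w where "w i = inv_into U X (l ! i)" for i
  have "finite U" "U \<noteq> {}" using fin pS Yp by (auto simp: U_def)
  then have l: "set l = X ` U" "sorted_wrt (<) l" "l \<noteq> []"
    by (auto simp: l_def)
  define n where "n = length l - 1"
  have length: "length l = Suc n" using l(3) by (simp add: n_def)
  then have len: "{..n} = {..<length l}" by (simp only: lessThan_Suc_atMost)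
  have X_w: "X (w i) = l ! i" if "i \<le> n" for i
  proof -
    have "l ! i \<in> X ` U" unfolding l(1)[symmetric] using that length by (intro nth_mem) simp
    then show ?thesis unfolding w_def by (rule f_inv_into_f)
  qed
  have "(!) l ` {..<length l} = X ` U"
    unfolding l(1)[symmetric] by (auto simp: set_conv_nth)
  moreover have "inv_into U X ` X ` U = U"
    using X_inj_upper by (intro inv_into_image_cancel) (auto simp: U_def)
  moreover have "w ` {..n} = inv_into U X ` (!) l ` {..<length l}"
    unfolding len image_image by (simp add: w_def)
  ultimately have img: "w ` {..n} = {v \<in> S. 0 \<le> Y v}" by (simp only: U_def)
  have inc: "X (w i) < X (w j)" if "i < j" "j \<le> n" for i j
    using that X_w[of i] X_w[of j] length sorted_wrt_nth_less[OF l(2), of i j] by simp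
  have "hull_order X Y S p R w n" using inc img by unfold_locales
  then show ?thesis by blast
qed

end

section \<open>Degree, stretch and planarity of the spanner\<close>

context hull_order
begin

lemma edge_mem:
  assumes "e \<in> upper_edges \<union> lower_edges"
  shows "\<exists>u v. e = {u, v} \<and> u \<noteq> v \<and> u \<in> S \<and> v \<in> S"
proof -
  have w: "w i \<noteq> w (Suc i) \<and> w i \<in> S \<and> w (Suc i) \<in> S" if "i < n" for i
    using that w_inj[of i "Suc i"] w_mem(1) by simp
  consider i where "i < n" "e = {w i, w (Suc i)}" | i where "i < n" "e = {- w i, - w (Suc i)}"
    using assms by (auto simp: upper_edges_def lower_edges_def)
  then show ?thesis
  proof cases
    case (1 i)
    then show ?thesis using w by blast
  next
    case (2 i)
    then show ?thesis
      using w[of i] minus_mem by (intro exI[of _ "- w i"] exI[of _ "- w (Suc i)"]) simp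
  qed
qed

lemma upper_neighbours:
  assumes "{x, w i} \<in> upper_edges" "i \<le> n"
  shows "0 < i \<and> x = w (i - 1) \<or> i < n \<and> x = w (Suc i)"
proof -
  obtain k where k: "k < n" "{x, w i} = {w k, w (Suc k)}" using assms(1) by (auto simp: upper_edges_def)
  then have "w i = w (Suc k) \<and> x = w k \<or> w i = w k \<and> x = w (Suc k)"
    by (auto simp: doubleton_eq_iff)
  then show ?thesis using w_inj[of i k] w_inj[of i "Suc k"] k(1) assms(2) by auto
qed

lemma lower_neighbours:
  assumes "{x, - w i} \<in> lower_edges" "i \<le> n"
  shows "0 < i \<and> x = - w (i - 1) \<or> i < n \<and> x = - w (Suc i)"
proof -
  obtain k where k: "k < n" "{x, - w i} = {- w k, - w (Suc k)}"
    using assms(1) by (auto simp: lower_edges_def)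
  then have "{- x, w i} = {w k, w (Suc k)}" by (auto simp: doubleton_eq_iff)
  then have "{- x, w i} \<in> upper_edges" using k(1) by (auto simp: upper_edges_def)
  from upper_neighbours[OF this assms(2)] show ?thesis
    by (elim disjE conjE) (auto dest: arg_cong[of _ _ uminus])
qed

lemma upper_edge_nonneg: "{x, v} \<in> upper_edges \<Longrightarrow> 0 \<le> Y v"
  using w_mem by (auto simp: upper_edges_def doubleton_eq_iff)

lemma lower_edge_nonpos: "{x, v} \<in> lower_edges \<Longrightarrow> Y v \<le> 0"
  using w_mem by (auto simp: lower_edges_def doubleton_eq_iff frame_simps)

text \<open>The points \<open>w 0, \<dots>, w n, - w 1, \<dots>, - w (n - 1)\<close> run clockwise around the hull, so edges
  \<open>{w i, - w j}\<close> and \<open>{w i', - w j'}\<close> are disjoint iff their indices are nested oppositely.\<close>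

definition matching_edges :: "(nat \<times> nat) set \<Rightarrow> point set set" where
  "matching_edges M = (\<lambda>(i, j). {w i, - w j}) ` M"

text \<open>A vertex has at most two hull neighbours, one on each chain at \<open>p\<close> and
  \<open>- p\<close> and both on its own chain elsewhere, and at most one matching partner.\<close>

lemma degree_le_3:
  assumes M: "M \<subseteq> {..n} \<times> {0<..<n}"
    and nest: "\<forall>(i,j)\<in>M. \<forall>(i',j')\<in>M. i < i' \<longleftrightarrow> j' < j"
    and v: "v \<in> S"
  shows "degree (upper_edges \<union> lower_edges \<union> matching_edges M) v \<le> 3"
proof -
  let ?N = "\<lambda>E. {x. {x, v} \<in> E}"
  have card_le_3: "degree E v \<le> 3" if "?N E \<subseteq> {a, b, c}" for E a b c
  proof -
    have "degree E v \<le> card {a, b, c}"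
      unfolding degree_def using that by (intro card_mono) auto
    also have "\<dots> \<le> 3" by (simp add: card_insert_if)
    finally show ?thesis .
  qed
  have M_mem: "i \<le> n \<and> 0 < j \<and> j < n" if "(i, j) \<in> M" for i j using M that by auto
  \<comment> \<open>With equal first indices, nesting read in both directions excludes
    \<open>j < j'\<close> and \<open>j' < j\<close>.\<close>
  have fst_unique: "j = j'" if "(i, j) \<in> M" "(i, j') \<in> M" for i j j'
    using bspec[OF bspec[OF nest that(1), unfolded split_conv] that(2)]
      bspec[OF bspec[OF nest that(2), unfolded split_conv] that(1)] by simp
  have snd_unique: "i = i'" if "(i, j) \<in> M" "(i', j) \<in> M" for i i' j
    using bspec[OF bspec[OF nest that(1), unfolded split_conv] that(2)]
      bspec[OF bspec[OF nest that(2), unfolded split_conv] that(1)] by simp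
  have upper_match: "\<exists>g. ?N (matching_edges M) \<subseteq> {g}" if i: "i \<le> n" "v = w i" for i
  proof -
    \<comment> \<open>For an unmatched point the \<open>SOME\<close> term is arbitrary, which is
      harmless as only an inclusion is claimed.\<close>
    have "x \<in> {- w (SOME j. (i, j) \<in> M)}" if xv: "{x, v} \<in> matching_edges M" for x
    proof -
      obtain a b where ab: "(a, b) \<in> M" "{x, w i} = {w a, - w b}"
        using xv i(2) by (auto simp: matching_edges_def)
      then have "w i = w a" "x = - w b"
        using w_neq_minus_w[of i b] i M_mem[OF ab(1)] by (auto simp: doubleton_eq_iff)
      then have "(i, b) \<in> M" using w_inj[of i a] i M_mem[OF ab(1)] ab(1) by auto
      then have "(SOME j. (i, j) \<in> M) = b" using fst_unique by blast
      then show ?thesis using \<open>x = - w b\<close> by simp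
    qed
    then show ?thesis by blast
  qed
  have lower_match: "\<exists>g. ?N (matching_edges M) \<subseteq> {g}" if j: "0 < j" "j < n" "v = - w j" for j
  proof -
    have "x \<in> {w (SOME i. (i, j) \<in> M)}" if xv: "{x, v} \<in> matching_edges M" for x
    proof -
      obtain a b where ab: "(a, b) \<in> M" "{x, - w j} = {w a, - w b}"
        using xv j(3) by (auto simp: matching_edges_def)
      then have "w j = w b" "x = w a"
        using w_neq_minus_w[of a j] j M_mem[OF ab(1)] by (auto simp: doubleton_eq_iff)
      then have "(a, j) \<in> M" using w_inj[of j b] j M_mem[OF ab(1)] ab(1) by auto
      then have "(SOME i. (i, j) \<in> M) = a" using snd_unique by blast
      then show ?thesis using \<open>x = w a\<close> by simp
    qed
    then show ?thesis by blast
  qed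
  consider "v = w 0" "v = - w n" | "v = w n" "v = - w 0"
    | i where "0 < i" "i < n" "v = w i" | j where "0 < j" "j < n" "v = - w j"
  proof (cases "0 \<le> Y v")
    case True
    then obtain i where i: "i \<le> n" "v = w i" using upper_index v by blast
    then consider "i = 0" | "i = n" | "0 < i" "i < n" by linarith
    then show ?thesis using that w_ends i by cases auto
  next
    case False
    then have "0 \<le> Y (- v)" by (simp add: frame_simps)
    then obtain j where "j \<le> n" "- v = w j" using upper_index minus_mem[OF v] by blast
    then have j: "j \<le> n" "v = - w j" by (auto simp: minus_equation_iff[of v])
    then consider "j = 0" | "j = n" | "0 < j" "j < n" by linarith
    then show ?thesis using that w_ends j by cases auto
  qed
  then show ?thesis
  proof cases
    case 1
    obtain g where "?N (matching_edges M) \<subseteq> {g}" using upper_match[of 0] 1 by auto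
    moreover have "?N upper_edges \<subseteq> {w 1}" using upper_neighbours[of _ 0] 1(1) by auto
    moreover have "?N lower_edges \<subseteq> {- w (n - 1)}" using lower_neighbours[of _ n] 1(2) by auto
    ultimately show ?thesis by (intro card_le_3[of _ "w 1" "- w (n - 1)" g]) blast
  next
    case 2
    obtain g where "?N (matching_edges M) \<subseteq> {g}" using upper_match[of n] 2 by auto
    moreover have "?N upper_edges \<subseteq> {w (n - 1)}" using upper_neighbours[of _ n] 2(1) by auto
    moreover have "?N lower_edges \<subseteq> {- w 1}" using lower_neighbours[of _ 0] 2(2) by auto
    ultimately show ?thesis by (intro card_le_3[of _ "w (n - 1)" "- w 1" g]) blast
  next
    case (3 i)
    obtain g where "?N (matching_edges M) \<subseteq> {g}" using upper_match[of i] 3 by auto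
    moreover have "?N upper_edges \<subseteq> {w (i - 1), w (Suc i)}" using upper_neighbours[of _ i] 3 by auto
    moreover have "?N lower_edges = {}" using lower_edge_nonpos[of _ v] w_interior[of i] 3 by fastforce
    ultimately show ?thesis by (intro card_le_3[of _ "w (i - 1)" "w (Suc i)" g]) blast
  next
    case (4 j)
    obtain g where "?N (matching_edges M) \<subseteq> {g}" using lower_match[of j] 4 by auto
    moreover have "?N lower_edges \<subseteq> {- w (j - 1), - w (Suc j)}" using lower_neighbours[of _ j] 4 by auto
    moreover have "?N upper_edges = {}"
      using upper_edge_nonneg[of _ v] w_interior[of j] 4 by (fastforce simp: frame_simps)
    ultimately show ?thesis by (intro card_le_3[of _ "- w (j - 1)" "- w (Suc j)" g]) blast
  qed
qed

text \<open>Pairs that are not nested oppositely share an index, where the triangle inequality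
  suffices, or their segments cross and \<open>crossing_diagonals\<close> applies.\<close>

lemma detour:
  assumes ij: "i \<le> n" "0 < j" "j < n" and ij': "i' \<le> n" "0 < j'" "j' < n"
    and block: "\<not> (i < i' \<and> j' < j)" "\<not> (i' < i \<and> j < j')"
  shows "dist (w i) (w i') + dist (- w j') (- w j) \<le> dist (w i) (- w j) + dist (w i') (- w j')"
proof -
  have cross: "dist (w i) (w i') + dist (- w j') (- w j) \<le> dist (w i) (- w j) + dist (w i') (- w j')"
    if "i < i'" "j < j'" "i' \<le> n" "0 < j" "j' < n" for i i' j j'
  proof (rule crossing_diagonals)
    have "orient (w i) (w i') (- w j) < 0" using orient_w_minus that by simp
    then show "orient (w i) (- w j) (w i') > 0"
      by (metis orient_rotate orient_swap neg_less_0_iff_less)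
    have "orient (- w j) (- w j') (w i) < 0" using orient_minus_w that by simp
    then show "orient (w i) (- w j) (- w j') < 0" by (metis orient_rotate)
    have "orient (w i) (w i') (- w j') < 0" using orient_w_minus that by simp
    then show "orient (w i') (- w j') (w i) < 0" by (metis orient_rotate)
    have "orient (- w j) (- w j') (w i') < 0" using orient_minus_w that by simp
    then show "orient (w i') (- w j') (- w j) > 0"
      by (metis orient_rotate orient_swap neg_less_0_iff_less)
  qed
  consider "i = i'" | "j = j'" | "i < i'" "j < j'" | "i' < i" "j' < j" using block by linarith
  then show ?thesis
  proof cases
    case 1
    then show ?thesis
      using dist_triangle[of "- w j'" "- w j" "w i"] dist_commute[of "w i" "- w j'"] by simp
  next
    case 2
    then show ?thesis
      using dist_triangle[of "w i" "w i'" "- w j"] dist_commute[of "w i'" "- w j"] by simp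
  next
    case 3
    then show ?thesis using cross ij ij' by simp
  next
    case 4
    then show ?thesis using cross[of i' i j' j] ij ij' by (simp add: dist_commute)
  qed
qed

lemma exists_spanner:
  "\<exists>E. geometric_graph S E \<and> plane_graph E \<and> stretch_factor_le S E (pi + 1)
    \<and> (\<forall>v\<in>S. degree E v \<le> 3)"
proof -
  \<comment> \<open>Lower indices omit 0 and \<open>n\<close>, so \<open>p\<close> and
    \<open>- p\<close> are matched as upper points only and every point of \<open>S\<close> occurs
    once.\<close>
  obtain M where M: "M \<subseteq> {..n} \<times> {0<..<n}"
    and nest: "\<forall>(i,j)\<in>M. \<forall>(i',j')\<in>M. i < i' \<longleftrightarrow> j' < j"
    and block: "\<forall>u\<in>{..n}. \<forall>v\<in>{0<..<n}. \<exists>(i,j)\<in>M. dist (w i) (- w j) \<le> dist (w u) (- w v) \<and>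
      \<not> (u < i \<and> j < v) \<and> \<not> (i < u \<and> v < j)"
    using blocking_matching[of "{..n}" "{0<..<n}" "\<lambda>i j. dist (w i) (- w j)"] by auto
  define E where "E = upper_edges \<union> lower_edges \<union> matching_edges M"
  have geo: "\<exists>u v. e = {u, v} \<and> u \<noteq> v \<and> u \<in> S \<and> v \<in> S" if e: "e \<in> E" for e
  proof (cases "e \<in> upper_edges \<union> lower_edges")
    case True
    then show ?thesis by (rule edge_mem)
  next
    case False
    then obtain i j where "(i, j) \<in> M" "e = {w i, - w j}" using e by (auto simp: E_def matching_edges_def)
    moreover from this have ij: "i \<le> n" "0 < j" "j < n" using M by auto
    ultimately show ?thesis
      using w_neq_minus_w[OF ij] w_mem(1)[OF ij(1)] minus_mem[OF w_mem(1)[of j]] by auto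
  qed
  have "convex hull e1 \<inter> convex hull e2 \<subseteq> e1 \<inter> e2" if e: "e1 \<in> E" "e2 \<in> E" "e1 \<noteq> e2" for e1 e2
  proof -
    obtain a b where ab: "e1 = {a, b}" "a \<noteq> b" "a \<in> S" "b \<in> S" using geo e(1) by blast
    obtain c d where cd: "e2 = {c, d}" "c \<noteq> d" "c \<in> S" "d \<in> S" using geo e(2) by blast
    consider "e1 \<in> upper_edges \<union> lower_edges" | "e2 \<in> upper_edges \<union> lower_edges"
      | "e1 \<in> matching_edges M" "e2 \<in> matching_edges M"
      using e by (auto simp: E_def)
    then show ?thesis
    proof cases
      case 1
      then show ?thesis using hull_edge_plane[OF 1 cd(3,4,2)] e(3) cd(1) by simp
    next
      case 2
      then show ?thesis using hull_edge_plane[OF 2 ab(3,4,2)] e(3) ab(1) by blast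
    next
      case 3
      then obtain i j i' j' where ij: "(i, j) \<in> M" "e1 = {w i, - w j}" "(i', j') \<in> M" "e2 = {w i', - w j'}"
        by (auto simp: matching_edges_def)
      have iff: "i < i' \<longleftrightarrow> j' < j" "i' < i \<longleftrightarrow> j < j'" using nest ij(1,3) by blast+
      have bd: "i \<le> n" "0 < j" "j < n" "i' \<le> n" "0 < j'" "j' < n" using M ij(1,3) by auto
      consider "i < i'" "j' < j" | "i' < i" "j < j'" | "i = i'" "j = j'" using iff by linarith
      then show ?thesis
      proof cases
        case 1
        then show ?thesis using matching_edges_plane[of i i' j' j] bd ij(2,4) by simp
      next
        case 2
        then show ?thesis using matching_edges_plane[of i' i j j'] bd ij(2,4) by blast
      next
        case 3
        then show ?thesis using ij e(3) by simp
      qed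
    qed
  qed
  then have plane: "plane_graph E" unfolding plane_graph_def by blast
  have mono: "walk E l u v" if "walk F l u v" "F \<subseteq> E" for F l u v
    using that by (induction rule: walk.induct) (auto intro: walk.intros)
  have upper: "\<exists>l \<le> pi / 2 * dist (w i) (w j). walk E l (w i) (w j)" if "i \<le> n" "j \<le> n" for i j
    using upper_chain_walk[OF that] mono[of upper_edges] by (auto simp: E_def)
  have lower: "\<exists>l \<le> pi / 2 * dist (- w i) (- w j). walk E l (- w i) (- w j)" if "i \<le> n" "j \<le> n" for i j
    using lower_chain_walk[OF that] mono[of lower_edges] by (auto simp: E_def)
  have weaken: "pi / 2 * dist u v \<le> (pi + 1) * dist u v" for u v :: point
    by (intro mult_right_mono) (use pi_gt_zero in auto)
  have across: "\<exists>l \<le> (pi + 1) * dist (w i) (- w j). walk E l (w i) (- w j)"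
    if ij: "i \<le> n" "0 < j" "j < n" for i j
  proof -
    obtain i' j' where m: "(i', j') \<in> M" "dist (w i') (- w j') \<le> dist (w i) (- w j)"
      "\<not> (i < i' \<and> j' < j)" "\<not> (i' < i \<and> j < j')"
      using bspec[OF bspec[OF block], of i j] ij by auto
    then have bd: "i' \<le> n" "0 < j'" "j' < n" using M by auto
    obtain l1 where l1: "l1 \<le> pi / 2 * dist (w i) (w i')" "walk E l1 (w i) (w i')"
      using upper[of i i'] ij bd by blast
    obtain l2 where l2: "l2 \<le> pi / 2 * dist (- w j') (- w j)" "walk E l2 (- w j') (- w j)"
      using lower[of j' j] ij bd by auto
    have "walk E (dist (w i') (- w j')) (w i') (- w j')"
      using m(1) by (intro walk_edge) (auto simp: E_def matching_edges_def)
    then have "walk E (l1 + (dist (w i') (- w j') + l2)) (w i) (- w j)"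
      using walk_trans[OF l1(2) walk_trans[OF _ l2(2)]] by blast
    moreover have "l1 + (dist (w i') (- w j') + l2) \<le> (pi + 1) * dist (w i) (- w j)"
    proof -
      \<comment> \<open>As the matching edge is no longer than \<open>dist (w i) (- w j)\<close>,
        the chain parts cost at most \<open>pi / 2 * 2\<close> times that distance and the edge at
        most once more.\<close>
      have "dist (w i) (w i') + dist (- w j') (- w j) \<le> 2 * dist (w i) (- w j)"
        using detour[OF ij bd m(3,4)] m(2) by linarith
      then have "pi / 2 * (dist (w i) (w i') + dist (- w j') (- w j)) \<le> pi / 2 * (2 * dist (w i) (- w j))"
        by (intro mult_left_mono) auto
      then show ?thesis using l1(1) l2(1) m(2) by (simp add: algebra_simps)
    qed
    ultimately show ?thesis by blast
  qed
  have "\<exists>l \<le> (pi + 1) * dist u v. walk E l u v" if uv: "u \<in> S" "v \<in> S" for u v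
  proof -
    have cases: "(\<exists>i\<le>n. v = w i) \<or> (\<exists>j. 0 < j \<and> j < n \<and> v = - w j)" if v: "v \<in> S" for v
    proof (cases "0 \<le> Y v")
      case True
      then show ?thesis using upper_index v by blast
    next
      case False
      then have "0 \<le> Y (- v)" by (simp add: frame_simps)
      then obtain j where "j \<le> n" "- v = w j" using upper_index minus_mem[OF v] by blast
      moreover from this have "v = - w j" by (metis minus_minus)
      \<comment> \<open>\<open>v\<close> is strictly below the axis, so its index is not that of
        \<open>p\<close> or \<open>- p\<close>.\<close>
      moreover have "Y (w j) \<noteq> 0" using False \<open>- v = w j\<close>[symmetric] by (simp add: frame_simps)
      then have "j \<noteq> 0" "j \<noteq> n" using Yp minus_p(3) w_ends(1,2) by metis+
      ultimately show ?thesis by auto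
    qed
    consider i j where "i \<le> n" "j \<le> n" "u = w i" "v = w j"
      | i j where "i \<le> n" "0 < j" "j < n" "u = w i" "v = - w j"
      | i j where "i \<le> n" "0 < j" "j < n" "v = w i" "u = - w j"
      | i j where "i < n" "j < n" "u = - w i" "v = - w j"
      using cases[OF uv(1)] cases[OF uv(2)] by blast
    then show ?thesis
    proof cases
      case (1 i j)
      then obtain l where "l \<le> pi / 2 * dist u v" "walk E l u v" using upper[of i j] by auto
      then show ?thesis using weaken[of u v] by (meson order_trans)
    next
      case (2 i j)
      then show ?thesis using across by blast
    next
      case (3 i j)
      then show ?thesis using across[of i j] walk_sym by (metis dist_commute)
    next
      case (4 i j)
      then obtain l where "l \<le> pi / 2 * dist u v" "walk E l u v" using lower[of i j] by auto
      then show ?thesis using weaken[of u v] by (meson order_trans)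
    qed
  qed
  then have "stretch_factor_le S E (pi + 1)"
    unfolding stretch_factor_le_def using walk_imp_is_walk by metis
  moreover have "geometric_graph S E" unfolding geometric_graph_def using geo by blast
  moreover have "\<forall>v\<in>S. degree E v \<le> 3" unfolding E_def using degree_le_3[OF M nest] by blast
  ultimately show ?thesis using plane by blast
qed

end

section \<open>Degenerate case and choice of the frame\<close>

theorem theorem5:
  fixes S :: "point set"
  assumes "finite S" and "centrally_symmetric S" and "convex_position S"
  shows "\<exists>E. geometric_graph S E \<and> plane_graph E \<and> stretch_factor_le S E (pi + 1)
             \<and> (\<forall>v\<in>S. degree E v \<le> 3)"
\<comment> \<open>Without a point other than the origin there is no axis; then the empty graph works
  with the one-point walk.\<close>
proof (cases "S \<subseteq> {0}")
  case True
  have "is_walk {} (0 :: point) [0] 0" "walk_length [0 :: point] = 0"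
    by (simp_all add: is_walk_def walk_length_def)
  then have "\<exists>xs. is_walk {} (0 :: point) xs 0 \<and> walk_length xs \<le> (pi + 1) * dist (0 :: point) 0"
    by (intro exI[of _ "[0]"]) simp
  then have "stretch_factor_le S {} (pi + 1)"
    using True unfolding stretch_factor_le_def by blast
  then show ?thesis
    by (intro exI[of _ "{}"]) (simp add: geometric_graph_def plane_graph_def degree_def)
next
  case False
  then have "S \<noteq> {}" by auto
  then obtain p where p: "p \<in> S" "\<And>v. v \<in> S \<Longrightarrow> norm v \<le> norm p"
    using assms(1) obtains_MAX[of S norm] by (metis Max_ge finite_imageI imageI)
  define R where "R = norm p"
  obtain v where "v \<in> S" "v \<noteq> 0" using False by blast
  then have "R > 0" using p(2)[of v] unfolding R_def by (metis norm_le_zero_iff not_le order_trans)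
  have norm2: "(norm v)\<^sup>2 = (v $ 1)\<^sup>2 + (v $ 2)\<^sup>2" for v :: point
    unfolding power2_norm_eq_inner by (simp add: inner_vec_def sum_2 power2_eq_square)
  have R2: "R\<^sup>2 = (p $ 1)\<^sup>2 + (p $ 2)\<^sup>2" unfolding R_def by (rule norm2)
  \<comment> \<open>Inner and cross product with the unit vector along \<open>p\<close>: the frame
    turned so that \<open>p\<close> has coordinates \<open>R\<close> and 0.\<close>
  define X Y :: "point \<Rightarrow> real"
    where "X v = (p $ 1 * v $ 1 + p $ 2 * v $ 2) / R" and "Y v = (p $ 1 * v $ 2 - p $ 2 * v $ 1) / R" for v
  interpret symmetric_hull X Y S p R
  proof unfold_locales
    fix v
    have "(X v)\<^sup>2 + (Y v)\<^sup>2 = ((p $ 1)\<^sup>2 + (p $ 2)\<^sup>2) * ((v $ 1)\<^sup>2 + (v $ 2)\<^sup>2) / R\<^sup>2"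
      by (simp add: X_def Y_def power_divide add_divide_distrib[symmetric])
        (simp add: power2_eq_square algebra_simps)
    then show "(norm v)\<^sup>2 = (X v)\<^sup>2 + (Y v)\<^sup>2"
      using \<open>R > 0\<close> by (simp add: norm2 R2[symmetric])
  next
    have "X p = R\<^sup>2 / R" unfolding R2 by (simp add: X_def power2_eq_square)
    then show "X p = R" by (simp add: power2_eq_square)
  qed (use assms p \<open>R > 0\<close> in \<open>auto simp: X_def Y_def R_def linear_iff add_divide_distrib diff_divide_distrib algebra_simps\<close>)
  obtain w n where "hull_order X Y S p R w n" using exists_hull_order by blast
  then show ?thesis by (rule hull_order.exists_spanner)
qed

end
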